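(* For every integer $k\ge 1$, $2\le \chi_{la}\big(\sum_{i=1}^k C^i_8\big)\le 4$, where $\sum_{i=1}^k C^i_8$ denotes the disjoint union of $k$ copies $C^1_8,\dots,C^k_8$ of the graph $C_8^*$ described below.
   Context: For a graph $G=(V,E)$ with $|E|=m$ and no isolated vertices, a local antimagic labeling is a bijection $f:E\to\{1,\dots,m\}$ such that $f^+(u)\ne f^+(v)$ for every edge $uv$, where $f^+(x)=\sum f(e)$ over all edges $e$ incident to $x$. The local antimagic chromatic number $\chi_{la}(G)$ is the minimum, over all local antimagic labelings $f$ of $G$, of the number of distinct values taken by $f^+$ (also for disconnected graphs). $C_8^*$ is the graph consisting of an 8-cycle $u_1u_2\cdots u_8u_1$ together with one additional vertex $x$ adjacent to $u_2$ and $u_6$ (9 vertices, 10 edges). *)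

theory Defs
  imports "HOL-Library.Extended_Nat"
begin

text \<open>An edge is the two-element set of its end vertices.\<close>

record 'a ugraph =
  uverts :: "'a set"
  uedges :: "'a set set"

definition simple_graph :: "'a ugraph \<Rightarrow> bool" where
  "simple_graph G \<longleftrightarrow>
     finite (uverts G) \<and> (\<forall>e\<in>uedges G. e \<subseteq> uverts G \<and> card e = 2)"

definition no_isolated_vertices :: "'a ugraph \<Rightarrow> bool" where
  "no_isolated_vertices G \<longleftrightarrow> (\<forall>v\<in>uverts G. \<exists>e\<in>uedges G. v \<in> e)"

definition disjoint_union :: "'i set \<Rightarrow> ('i \<Rightarrow> 'a ugraph) \<Rightarrow> ('i \<times> 'a) ugraph" where
  "disjoint_union I G =
     \<lparr>uverts = (SIGMA i:I. uverts (G i)),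
      uedges = (\<Union>i\<in>I. (\<lambda>e. Pair i ` e) ` uedges (G i))\<rparr>"

definition vertex_weight :: "'a ugraph \<Rightarrow> ('a set \<Rightarrow> nat) \<Rightarrow> 'a \<Rightarrow> nat" where
  "vertex_weight G f x = (\<Sum>e\<in>{e \<in> uedges G. x \<in> e}. f e)"

definition local_antimagic_labeling :: "'a ugraph \<Rightarrow> ('a set \<Rightarrow> nat) \<Rightarrow> bool" where
  "local_antimagic_labeling G f \<longleftrightarrow>
     bij_betw f (uedges G) {1..card (uedges G)} \<and>
     (\<forall>u v. {u, v} \<in> uedges G \<longrightarrow> vertex_weight G f u \<noteq> vertex_weight G f v)"

text \<open>The infimum is a minimum whenever some local antimagic labeling exists; it is taken in
  \<^typ>\<open>enat\<close> so that a graph without such a labeling gets the value \<^term>\<open>\<infinity>\<close>. The notion is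
  meant for finite simple graphs without isolated vertices.\<close>

definition chi_la :: "'a ugraph \<Rightarrow> enat" where
  "chi_la G = (INF f \<in> {f. local_antimagic_labeling G f}.
                 enat (card (vertex_weight G f ` uverts G)))"

datatype c8_vertex = U nat | X

definition C8_star :: "c8_vertex ugraph" where
  "C8_star =
     \<lparr>uverts = {U 1, U 2, U 3, U 4, U 5, U 6, U 7, U 8, X},
      uedges = {{U 1, U 2}, {U 2, U 3}, {U 3, U 4}, {U 4, U 5}, {U 5, U 6}, {U 6, U 7},
                {U 7, U 8}, {U 8, U 1}, {X, U 2}, {X, U 6}}\<rparr>"

lemma card_C8_star: "card (uverts C8_star) = 9" "card (uedges C8_star) = 10"
  by (simp_all add: C8_star_def doubleton_eq_iff)

lemma simple_graph_C8_star: "simple_graph C8_star"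
  by (simp add: simple_graph_def C8_star_def)

lemma no_isolated_vertices_C8_star: "no_isolated_vertices C8_star"
  by (simp add: no_isolated_vertices_def C8_star_def)

lemma simple_graph_disjoint_union:
  assumes "finite I" and "\<And>i. i \<in> I \<Longrightarrow> simple_graph (G i)"
  shows "simple_graph (disjoint_union I G)"
proof -
  have card_Pair: "card (Pair i ` e) = card e" for i :: 'a and e :: "'b set"
    by (rule card_image) (simp add: inj_on_def)
  have "finite (uverts (disjoint_union I G))"
    using assms by (auto simp: simple_graph_def disjoint_union_def)
  moreover have "e \<subseteq> uverts (disjoint_union I G) \<and> card e = 2"
    if "e \<in> uedges (disjoint_union I G)" for e
  proof -
    from that obtain i d where i: "i \<in> I" and d: "d \<in> uedges (G i)" and e: "e = Pair i ` d"
      by (auto simp: disjoint_union_def)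
    from assms(2)[OF i] d have "d \<subseteq> uverts (G i)" "card d = 2"
      by (auto simp: simple_graph_def)
    then show ?thesis
      using i by (auto simp: e card_Pair disjoint_union_def)
  qed
  ultimately show ?thesis by (simp add: simple_graph_def)
qed

lemma no_isolated_vertices_disjoint_union:
  assumes "\<And>i. i \<in> I \<Longrightarrow> no_isolated_vertices (G i)"
  shows "no_isolated_vertices (disjoint_union I G)"
  unfolding no_isolated_vertices_def
proof
  fix p assume "p \<in> uverts (disjoint_union I G)"
  then obtain i v where p: "p = (i, v)" and i: "i \<in> I" and v: "v \<in> uverts (G i)"
    by (auto simp: disjoint_union_def)
  from assms[OF i] v obtain d where d: "d \<in> uedges (G i)" "v \<in> d"
    by (auto simp: no_isolated_vertices_def)
  have "Pair i ` d \<in> uedges (disjoint_union I G)"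
    using i d by (auto simp: disjoint_union_def)
  moreover have "p \<in> Pair i ` d" using d by (simp add: p)
  ultimately show "\<exists>e\<in>uedges (disjoint_union I G). p \<in> e" by blast
qed

end

theory Submission
  imports Defs
begin

text \<open>The graph \<open>C\<^sub>8\<^sup>*\<close> is bipartite with parts \<open>{u\<^sub>2, u\<^sub>4, u\<^sub>6, u\<^sub>8}\<close> and
  \<open>{u\<^sub>1, u\<^sub>3, u\<^sub>5, u\<^sub>7, x}\<close>, and every vertex of the second part has degree 2. Put \<open>M = 10k + 1\<close>
  and give the two edges at each vertex of the second part complementary labels \<open>j\<close> and \<open>M - j\<close>.
  If \<open>p, r, t\<close> are the labels of the edges from \<open>u\<^sub>2\<close> to \<open>u\<^sub>3, u\<^sub>1, x\<close> and the edges \<open>u\<^sub>4u\<^sub>5\<close> and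
  \<open>u\<^sub>8u\<^sub>7\<close> get \<open>p + 1\<close> and \<open>r + 1\<close>, then \<open>u\<^sub>4\<close> and \<open>u\<^sub>8\<close> have weight \<open>M + 1\<close>, while \<open>u\<^sub>2\<close> and \<open>u\<^sub>6\<close> have
  weights \<open>c = p + r + t\<close> and \<open>3M - 2 - c\<close>. It remains to choose, in the \<open>i\<close>-th copy, \<open>p, r, t\<close> with
  constant sum so that \<open>p, p + 1, r, r + 1, t\<close> represent every pair \<open>{j, M - j}\<close> once: the
  numbers \<open>p, p + 1, r, r + 1\<close> run through the numbers above \<open>5k\<close> not congruent to 3 modulo 5, and
  \<open>t = 10(k - i) + 8\<close> compensates the growth of \<open>p + r\<close>. The lower bound holds
  because the ends of an edge have different weights.\<close>

lemma chi_la_ge_2: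
  assumes "simple_graph G" and "{u, v} \<in> uedges G"
  shows "2 \<le> chi_la G"
  unfolding chi_la_def
proof (rule INF_greatest)
  fix f assume "f \<in> {f. local_antimagic_labeling G f}"
  then have ne: "vertex_weight G f u \<noteq> vertex_weight G f v"
    using assms(2) by (simp add: local_antimagic_labeling_def)
  have "finite (uverts G)" "{u, v} \<subseteq> uverts G"
    using assms unfolding simple_graph_def by blast+
  then have "card (vertex_weight G f ` {u, v}) \<le> card (vertex_weight G f ` uverts G)"
    by (intro card_mono image_mono finite_imageI)
  with ne have "2 \<le> card (vertex_weight G f ` uverts G)" by simp
  then show "2 \<le> enat (card (vertex_weight G f ` uverts G))"
    by (simp add: numeral_eq_enat)
qed

lemma chi_la_le:
  assumes "local_antimagic_labeling G f" and "finite W" and "vertex_weight G f ` uverts G \<subseteq> W"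
  shows "chi_la G \<le> enat (card W)"
proof -
  have "chi_la G \<le> enat (card (vertex_weight G f ` uverts G))"
    unfolding chi_la_def using assms(1) by (intro INF_lower) simp
  also have "\<dots> \<le> enat (card W)"
    using assms(2,3) by (simp add: card_mono)
  finally show ?thesis .
qed

text \<open>A nonempty edge of the union determines its copy, whereas an empty edge would be shared
  by all copies.\<close>

lemma bij_betw_edges_disjoint_union:
  assumes "\<And>i. i \<in> I \<Longrightarrow> {} \<notin> uedges (G i)"
  shows "bij_betw (\<lambda>(i, d). Pair i ` d) (SIGMA i:I. uedges (G i)) (uedges (disjoint_union I G))"
  unfolding bij_betw_def
proof
  show "inj_on (\<lambda>(i, d). Pair i ` d) (SIGMA i:I. uedges (G i))"
  proof (rule inj_on_inverseI[where g = "\<lambda>e. (the_elem (fst ` e), snd ` e)"])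
    fix z assume "z \<in> (SIGMA i:I. uedges (G i))"
    then obtain i d where z: "z = (i, d)" and "i \<in> I" "d \<in> uedges (G i)" by auto
    with assms have "d \<noteq> {}" by metis
    with z show "(the_elem (fst ` (\<lambda>(i, d). Pair i ` d) z), snd ` (\<lambda>(i, d). Pair i ` d) z) = z"
      by (simp add: image_image image_constant_conv)
  qed
  show "(\<lambda>(i, d). Pair i ` d) ` (SIGMA i:I. uedges (G i)) = uedges (disjoint_union I G)"
    by (force simp: disjoint_union_def)
qed

lemma vertex_weight_disjoint_union:
  assumes "i \<in> I" and "\<And>d. d \<in> uedges (G i) \<Longrightarrow> f (Pair i ` d) = g d"
  shows "vertex_weight (disjoint_union I G) f (i, v) = vertex_weight (G i) g v"
proof -
  have "{e \<in> uedges (disjoint_union I G). (i, v) \<in> e} = (`) (Pair i) ` {d \<in> uedges (G i). v \<in> d}"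
    using assms(1) by (auto simp: disjoint_union_def)
  moreover have "inj_on ((`) (Pair i)) {d \<in> uedges (G i). v \<in> d}"
    by (rule inj_on_inverseI[where g = "(`) snd"]) (simp add: image_image)
  ultimately show ?thesis
    unfolding vertex_weight_def by (simp add: sum.reindex assms(2))
qed

text \<open>Consecutive branches are complementary pairs with sum \<open>10*k + 1\<close>, at
  \<open>U 3\<close>, \<open>U 5\<close>, \<open>U 1\<close>, \<open>U 7\<close>, \<open>X\<close>
  in turn; the default is \<open>{X, U 6}\<close>. Here \<open>p = 5*k + 5*i - 4\<close> and
  \<open>r = 5*k + 5*i - 1\<close>.\<close>

definition c8_label :: "nat \<Rightarrow> nat \<Rightarrow> c8_vertex set \<Rightarrow> nat" where
  "c8_label k i d =
     (if d = {U 2, U 3} then 5*k + 5*i - 4 else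
      if d = {U 3, U 4} then 5*k + 5 - 5*i else
      if d = {U 4, U 5} then 5*k + 5*i - 3 else
      if d = {U 5, U 6} then 5*k + 4 - 5*i else
      if d = {U 1, U 2} then 5*k + 5*i - 1 else
      if d = {U 8, U 1} then 5*k + 2 - 5*i else
      if d = {U 7, U 8} then 5*k + 5*i else
      if d = {U 6, U 7} then 5*k + 1 - 5*i else
      if d = {X, U 2} then 10*k + 8 - 10*i else 10*i - 7)"

lemma c8_label_simps:
  "c8_label k i {U 2, U 3} = 5*k + 5*i - 4"
  "c8_label k i {U 3, U 4} = 5*k + 5 - 5*i"
  "c8_label k i {U 4, U 5} = 5*k + 5*i - 3"
  "c8_label k i {U 5, U 6} = 5*k + 4 - 5*i"
  "c8_label k i {U 1, U 2} = 5*k + 5*i - 1"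
  "c8_label k i {U 8, U 1} = 5*k + 2 - 5*i"
  "c8_label k i {U 7, U 8} = 5*k + 5*i"
  "c8_label k i {U 6, U 7} = 5*k + 1 - 5*i"
  "c8_label k i {X, U 2} = 10*k + 8 - 10*i"
  "c8_label k i {X, U 6} = 10*i - 7"
  by (simp_all add: c8_label_def doubleton_eq_iff)

text \<open>For \<open>i \<in> {1..k}\<close> no subtraction in the labels truncates, so the terms
  in \<open>i\<close> cancel.\<close>

lemma vertex_weight_c8_label:
  assumes "i \<in> {1..k}"
  shows "v \<in> {U 1, U 3, U 5, U 7, X} \<Longrightarrow> vertex_weight C8_star (c8_label k i) v = 10*k + 1"
    and "v \<in> {U 4, U 8} \<Longrightarrow> vertex_weight C8_star (c8_label k i) v = 10*k + 2"
    and "vertex_weight C8_star (c8_label k i) (U 2) = 20*k + 3"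
    and "vertex_weight C8_star (c8_label k i) (U 6) = 10*k - 2"
proof -
  have weight: "vertex_weight C8_star f x =
      (\<Sum>e\<in>{{U 1, U 2}, {U 2, U 3}, {U 3, U 4}, {U 4, U 5}, {U 5, U 6}, {U 6, U 7},
          {U 7, U 8}, {U 8, U 1}, {X, U 2}, {X, U 6}}. if x \<in> e then f e else 0)" for f x
    unfolding vertex_weight_def C8_star_def ugraph.simps by (intro sum.inter_filter) simp
  note simps = weight doubleton_eq_iff c8_label_simps
  show "v \<in> {U 1, U 3, U 5, U 7, X} \<Longrightarrow> vertex_weight C8_star (c8_label k i) v = 10*k + 1"
    using assms by (auto simp: simps simp del: One_nat_def)
  show "v \<in> {U 4, U 8} \<Longrightarrow> vertex_weight C8_star (c8_label k i) v = 10*k + 2"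
    using assms by (auto simp: simps simp del: One_nat_def)
  show "vertex_weight C8_star (c8_label k i) (U 2) = 20*k + 3"
    using assms by (simp add: simps del: One_nat_def)
  show "vertex_weight C8_star (c8_label k i) (U 6) = 10*k - 2"
    using assms by (simp add: simps del: One_nat_def)
qed

lemma c8_label_surj:
  assumes "n \<in> {1..10*k}"
  shows "\<exists>i\<in>{1..k}. \<exists>d\<in>uedges C8_star. c8_label k i d = n"
proof -
  have "\<exists>i\<in>{1..k}. n = 5*k + 5*i - 4 \<or> n = 5*k + 5 - 5*i \<or> n = 5*k + 5*i - 3 \<or> n = 5*k + 4 - 5*i \<or>
      n = 5*k + 5*i - 1 \<or> n = 5*k + 2 - 5*i \<or> n = 5*k + 5*i \<or> n = 5*k + 1 - 5*i \<or>
      n = 10*k + 8 - 10*i \<or> n = 10*i - 7" (is "\<exists>i\<in>_. ?P i")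
  \<comment> \<open>The residue 3 modulo 5 belongs to the edges at \<open>X\<close>: 3 modulo 10 at
    \<open>U 6\<close>, 8 modulo 10 at \<open>U 2\<close>.\<close>
  proof (cases "n mod 5 = 3")
    case True
    then have "n mod 10 = 3 \<or> n mod 10 = 8" by presburger
    then show ?thesis
    proof
      assume "n mod 10 = 3"
      then have "n = 10 * (n div 10 + 1) - 7" by presburger
      with assms show ?thesis by (intro bexI[of _ "n div 10 + 1"]) auto
    next
      assume "n mod 10 = 8"
      then have "n = 10 * (n div 10) + 8" by presburger
      with assms have "n div 10 < k" "n = 10*k + 8 - 10 * (k - n div 10)" by auto
      then show ?thesis by (intro bexI[of _ "k - n div 10"]) auto
    qed
  next
    case False
    \<comment> \<open>Blocks of five starting at 1: \<open>q < k\<close> gives the smaller label of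
      a pair, in copy \<open>k - q\<close>; otherwise it is the larger one, in copy
      \<open>q - k + 1\<close>.\<close>
    define q r where "q = (n - 1) div 5" and "r = (n - 1) mod 5"
    have "n - 1 = 5*q + r" by (simp add: q_def r_def)
    with assms have n: "n = 5*q + r + 1" by auto
    have "r < 5" by (simp add: r_def)
    moreover have "r \<noteq> 2" using False by (auto simp: n)
    ultimately have r: "r = 0 \<or> r = 1 \<or> r = 3 \<or> r = 4" by linarith
    show ?thesis
    proof (cases "q < k")
      case True
      then obtain j where j: "k = q + j" "j \<ge> 1" by (metis less_imp_add_positive Suc_leI One_nat_def)
      then have "n = 5*k + r + 1 - 5*j" by (simp add: n)
      with r j show ?thesis by (intro bexI[of _ j]) auto
    next
      case False
      then obtain j where j: "q = k + j" using le_Suc_ex not_less by blast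
      have "j < k" using assms n j by auto
      moreover have "n = 5*k + 5*(j+1) + r - 4" by (simp add: n j)
      ultimately show ?thesis using r by (intro bexI[of _ "j + 1"]) auto
    qed
  qed
  moreover have "?P i \<longleftrightarrow> (\<exists>d\<in>uedges C8_star. c8_label k i d = n)" for i
    unfolding C8_star_def ugraph.simps bex_simps c8_label_simps by blast
  ultimately show ?thesis by blast
qed

lemma bij_betw_c8_label:
  "bij_betw (\<lambda>(i, d). c8_label k i d) ({1..k} \<times> uedges C8_star) {1..10*k}"
proof -
  let ?A = "{1..k} \<times> uedges C8_star" and ?g = "\<lambda>(i, d). c8_label k i d"
  have img: "?g ` ?A = {1..10*k}"
  proof
    show "?g ` ?A \<subseteq> {1..10*k}" by (auto simp: C8_star_def c8_label_simps simp del: One_nat_def)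
    show "{1..10*k} \<subseteq> ?g ` ?A" using c8_label_surj by (fastforce simp: image_iff)
  qed
  have "finite ?A" by (simp add: C8_star_def)
  \<comment> \<open>Both sides have \<open>10*k\<close> elements, so surjectivity yields
    injectivity.\<close>
  moreover have "card (?g ` ?A) = card ?A"
    unfolding img by (simp add: card_cartesian_product card_C8_star)
  ultimately have "inj_on ?g ?A" by (rule eq_card_imp_inj_on)
  with img show ?thesis by (simp add: bij_betw_def)
qed

lemma local_antimagic_labeling_C8_star_union:
  obtains f where
    "local_antimagic_labeling (disjoint_union {1..k} (\<lambda>i. C8_star)) f"
    "vertex_weight (disjoint_union {1..k} (\<lambda>i. C8_star)) f ` uverts (disjoint_union {1..k} (\<lambda>i. C8_star))
      \<subseteq> {10*k + 1, 10*k + 2, 20*k + 3, 10*k - 2}"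
proof -
  let ?G = "disjoint_union {1..k} (\<lambda>i. C8_star)"
  let ?h = "\<lambda>(i, d). Pair i ` d" and ?A = "{1..k} \<times> uedges C8_star"
  define f where "f e = c8_label k (the_elem (fst ` e)) (snd ` e)" for e :: "(nat \<times> c8_vertex) set"
  have ne: "{} \<notin> uedges C8_star" by (simp add: C8_star_def)
  have f: "f (Pair i ` d) = c8_label k i d" if "d \<in> uedges C8_star" for i d
    using that ne by (cases "d = {}") (simp_all add: f_def image_image image_constant_conv)
  have h: "bij_betw ?h ?A (uedges ?G)"
    using ne by (intro bij_betw_edges_disjoint_union)
  have "bij_betw (f \<circ> ?h) ?A {1..10*k}"
    using bij_betw_c8_label by (rule bij_betw_cong[THEN iffD1, rotated]) (auto simp: f)
  with h have bij: "bij_betw f (uedges ?G) {1..10*k}"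
    by (simp add: bij_betw_comp_iff)
  have weight: "vertex_weight ?G f (i, v) = vertex_weight C8_star (c8_label k i) v"
    if "i \<in> {1..k}" for i v
    using that f by (intro vertex_weight_disjoint_union)
  have "vertex_weight ?G f u \<noteq> vertex_weight ?G f v" if uv: "{u, v} \<in> uedges ?G" for u v
  proof -
    from uv obtain i d where i: "i \<in> {1..k}" and d: "d \<in> uedges C8_star" "{u, v} = Pair i ` d"
      by (auto simp: disjoint_union_def)
    \<comment> \<open>By the bipartition, exactly one end of each edge has weight
      \<open>10*k + 1\<close>.\<close>
    have "\<forall>d\<in>uedges C8_star. \<exists>a\<in>{U 1, U 3, U 5, U 7, X}. \<exists>b\<in>{U 2, U 4, U 6, U 8}. d = {a, b}"
      by (simp add: C8_star_def doubleton_eq_iff)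
    from bspec[OF this d(1)] obtain a b where a: "a \<in> {U 1, U 3, U 5, U 7, X}"
      and b: "b \<in> {U 2, U 4, U 6, U 8}" and "d = {a, b}"
      by (elim bexE) (rule that)
    with d(2) have uv_eq: "{u, v} = {(i, a), (i, b)}" by simp
    have "vertex_weight ?G f (i, a) \<noteq> vertex_weight ?G f (i, b)"
      using b i unfolding weight[OF i] vertex_weight_c8_label(1)[OF i a]
      by (auto simp: vertex_weight_c8_label)
    with uv_eq show ?thesis by (auto simp: doubleton_eq_iff)
  qed
  moreover have "card (uedges ?G) = 10*k"
    using bij_betw_same_card[OF bij] by simp
  ultimately have "local_antimagic_labeling ?G f"
    using bij by (simp add: local_antimagic_labeling_def)
  moreover have "vertex_weight ?G f ` uverts ?G \<subseteq> {10*k + 1, 10*k + 2, 20*k + 3, 10*k - 2}"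
  proof
    fix w assume "w \<in> vertex_weight ?G f ` uverts ?G"
    then obtain i v where i: "i \<in> {1..k}" and v: "v \<in> uverts C8_star" and w: "w = vertex_weight ?G f (i, v)"
      by (auto simp: disjoint_union_def)
    have "v \<in> {U 1, U 3, U 5, U 7, X} \<or> v \<in> {U 4, U 8} \<or> v = U 2 \<or> v = U 6"
      using v by (auto simp: C8_star_def)
    then show "w \<in> {10*k + 1, 10*k + 2, 20*k + 3, 10*k - 2}"
      unfolding w weight[OF i] using vertex_weight_c8_label[OF i] by blast
  qed
  ultimately show thesis by (rule that)
qed

theorem theorem4p1:
  fixes k :: nat
  assumes "k \<ge> 1"
  shows "2 \<le> chi_la (disjoint_union {1..k} (\<lambda>i. C8_star))
         \<and> chi_la (disjoint_union {1..k} (\<lambda>i. C8_star)) \<le> 4"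
proof
  let ?G = "disjoint_union {1..k} (\<lambda>i. C8_star)"
  have "{U 1, U 2} \<in> uedges C8_star" by (simp add: C8_star_def)
  with assms have "Pair 1 ` {U 1, U 2} \<in> uedges ?G"
    unfolding disjoint_union_def ugraph.simps by (intro UN_I[of 1] imageI) simp_all
  then have edge: "{(1, U 1), (1, U 2)} \<in> uedges ?G" by simp
  have "simple_graph ?G"
    by (intro simple_graph_disjoint_union simple_graph_C8_star finite_atLeastAtMost)
  then show "2 \<le> chi_la ?G" using edge by (rule chi_la_ge_2)
  let ?W = "{10*k + 1, 10*k + 2, 20*k + 3, 10*k - 2}"
  obtain f where "local_antimagic_labeling ?G f" "vertex_weight ?G f ` uverts ?G \<subseteq> ?W"
    by (rule local_antimagic_labeling_C8_star_union)
  then have "chi_la ?G \<le> enat (card ?W)" by (intro chi_la_le) auto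
  \<comment> \<open>Any coincidence among the four values would only lower the count.\<close>
  also have "\<dots> \<le> 4" by (simp add: card_insert_if numeral_eq_enat)
  finally show "chi_la ?G \<le> 4" .
qed

end
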